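(* Assume that $(\mathbf{A}_f,\mathbf{M}_f)$ is stabilizable and that the latent force has an exponentially stable state space representation, i.e. all eigenvalues of $\mathbf{A}_u$ have negative real part. Then the full system $\dot{\mathbf{g}}=\mathbf{A}\mathbf{g}+\mathbf{B}\mathbf{w}+\mathbf{M}\mathbf{c}$ is stabilizable, i.e. the pair $(\mathbf{A},\mathbf{M})$ is stabilizable.
   Context: The controlled latent force model is $\dot{\mathbf{g}}(t)=\mathbf{A}\mathbf{g}(t)+\mathbf{B}\mathbf{w}(t)+\mathbf{M}\mathbf{c}(t)$ with $\mathbf{g}=(\mathbf{f},\mathbf{u})\in\mathbb{R}^{n_f}\times\mathbb{R}^{n_u}$, $$\mathbf{A}=\begin{pmatrix}\mathbf{A}_f&\mathbf{B}_f\mathbf{C}_u\\ \mathbf{0}&\mathbf{A}_u\end{pmatrix},\quad \mathbf{B}=\begin{pmatrix}\mathbf{0}\\ \mathbf{B}_u\end{pmatrix},\quad \mathbf{M}=\begin{pmatrix}\mathbf{M}_f\\ \mathbf{0}\end{pmatrix},$$ where all blocks are constant real matrices of compatible dimensions, $\mathbf{f}$ is the state of the physical system, $\mathbf{u}$ the state of the latent force, $\mathbf{w}$ white noise and $\mathbf{c}$ the control. A pair $(\mathbf{F},\mathbf{N})$ of real matrices is stabilizable if there is a (finite, real) gain matrix $\mathbf{G}_c$ such that the system $\dot{\tilde{\mathbf{x}}}=(\mathbf{F}+\mathbf{N}\mathbf{G}_c)\tilde{\mathbf{x}}$ is exponentially stable. *)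

theory Defs
  imports "HOL-Analysis.Analysis"
begin

definition block_rows :: "'a^'n^'k \<Rightarrow> 'a^'n^'l \<Rightarrow> 'a^'n^('k + 'l)" where
  "block_rows P Q = (\<chi> i. case i of Inl a \<Rightarrow> P $ a | Inr b \<Rightarrow> Q $ b)"

definition block_cols :: "'a^'k^'n \<Rightarrow> 'a^'l^'n \<Rightarrow> 'a^('k + 'l)^'n" where
  "block_cols P Q = (\<chi> i j. case j of Inl a \<Rightarrow> P $ i $ a | Inr b \<Rightarrow> Q $ i $ b)"

definition is_eigenvalue :: "'a::field^'n^'n \<Rightarrow> 'a \<Rightarrow> bool" where
  "is_eigenvalue F z \<longleftrightarrow> (\<exists>v. v \<noteq> 0 \<and> F *v v = z *s v)"

text \<open>Initial time 0 and one-sided differentiability there suffice, as the system is autonomous.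
  The constants \<open>K\<close> and \<open>r\<close> do not depend on the trajectory.\<close>

definition linear_trajectory :: "real^'n^'n \<Rightarrow> (real \<Rightarrow> real^'n) \<Rightarrow> bool" where
  "linear_trajectory F x \<longleftrightarrow>
     (\<forall>t\<ge>0. (x has_vector_derivative (F *v x t)) (at t within {0..}))"

definition exponentially_stable :: "real^'n^'n \<Rightarrow> bool" where
  "exponentially_stable F \<longleftrightarrow>
     (\<exists>K>0. \<exists>r>0. \<forall>x. linear_trajectory F x \<longrightarrow>
        (\<forall>t\<ge>0. norm (x t) \<le> K * exp (- r * t) * norm (x 0)))"

definition stabilizable :: "real^'n^'n \<Rightarrow> real^'m^'n \<Rightarrow> bool" where
  "stabilizable F N \<longleftrightarrow> (\<exists>G :: real^'n^'m. exponentially_stable (F + N ** G))"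

end

theory Submission
  imports Defs "HOL-Real_Asymp.Real_Asymp" "HOL-Computational_Algebra.Fundamental_Theorem_Algebra"
begin

text \<open>Exponential stability of a real matrix is equivalent to all its eigenvalues having negative
  real part.  The spectrum of a block triangular matrix lies in the union of the spectra of the
  diagonal blocks, so a gain that stabilizes the physical system, extended by zero on the latent
  force, stabilizes the full system.

  That the spectral condition implies stability is shown without matrix exponentials or normal
  forms.  Some nonzero polynomial annihilates the matrix \<open>F\<close>; along its linear factors
  \<open>F - z\<close>, a trajectory \<open>y\<close> yields the trajectory \<open>w = y' - z y\<close>, and if \<open>w\<close> decays like
  \<open>exp (- r t)\<close> and \<open>Re z < - r\<close>, then so does \<open>y\<close>.  Factors with \<open>z\<close> not an eigenvalue are
  invertible and can be cancelled.\<close>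

section \<open>Matrix polynomials\<close>

text \<open>Horner evaluation of \<open>p\<close> at \<open>F\<close> under matrix multiplication,
  with a scalar \<open>a\<close> read as the scalar matrix \<open>mat a\<close>.\<close>

definition mat_poly :: "'a::comm_ring_1^'n^'n \<Rightarrow> 'a poly \<Rightarrow> 'a^'n^'n" where
  "mat_poly F p = fold_coeffs (\<lambda>a M. mat a + F ** M) p 0"

lemma mat_0_eq [simp]: "mat 0 = (0 :: 'a::zero^'n^'n)"
  by (simp add: mat_def vec_eq_iff)

lemma mat_add: "mat (a + b) = mat a + (mat b :: 'a::monoid_add^'n^'n)"
  by (simp add: mat_def vec_eq_iff)

lemma mat_matrix_mul_eq: "mat a ** M = (\<chi> i. a *s (M $ i))"
  for M :: "'a::comm_ring_1^'n^'m"
  by (simp add: mat_def matrix_matrix_mult_def vec_eq_iff if_distrib [of "\<lambda>x. x * _"]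
      cong: if_cong)

lemma matrix_mul_mat_commute: "M ** mat a = mat a ** M"
  for M :: "'a::comm_ring_1^'n^'n"
  unfolding mat_matrix_mul_eq
  by (simp add: mat_def matrix_matrix_mult_def vec_eq_iff if_distrib [of "\<lambda>x. _ * x"] mult.commute
      cong: if_cong)

lemma mat_matrix_mul_mat: "mat a ** mat b = (mat (a * b) :: 'a::comm_ring_1^'n^'n)"
  by (simp add: mat_matrix_mul_eq) (simp add: mat_def vec_eq_iff)

lemma mat_vector_mul_eq: "mat a *v v = a *s v"
  for v :: "'a::comm_ring_1^'n"
  by (simp add: mat_def matrix_vector_mult_def vec_eq_iff if_distrib [of "\<lambda>x. x * _"]
      cong: if_cong)

lemma matrix_mul_zero_right: "M ** 0 = (0 :: 'a::comm_ring_1^'n^'m)"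
  by (simp add: matrix_matrix_mult_def vec_eq_iff)

lemma matrix_add_mult_rdistrib: "(A + B) ** C = A ** C + B ** C"
  for A B :: "'a::semiring_1^'n^'m"
  by (simp add: matrix_matrix_mult_def vec_eq_iff distrib_right sum.distrib)

lemma mat_poly_0 [simp]: "mat_poly F 0 = 0"
  by (simp add: mat_poly_def)

lemma mat_poly_pCons [simp]: "mat_poly F (pCons a p) = mat a + F ** mat_poly F p"
  \<comment> \<open>When both are zero, \<open>pCons 0 0\<close> collapses to \<open>0\<close>, so
    \<open>fold_coeffs\<close> makes no Horner step; both sides are then zero anyway.\<close>
  by (cases "p = 0 \<and> a = 0") (auto simp: mat_poly_def matrix_mul_zero_right)

lemma mat_poly_add: "mat_poly F (p + q) = mat_poly F p + mat_poly F q"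
proof (induction p arbitrary: q)
  case (pCons a p)
  then show ?case
    by (cases q) (simp add: mat_add matrix_add_ldistrib)
qed simp

lemma mat_poly_sum: "mat_poly F (sum f S) = (\<Sum>i\<in>S. mat_poly F (f i))"
  by (induction S rule: infinite_finite_induct) (simp_all add: mat_poly_add)

lemma mat_poly_smult: "mat_poly F (smult a p) = mat a ** mat_poly F p"
proof (induction p)
  case (pCons b p)
  have "mat_poly F (smult a (pCons b p)) = mat (a * b) + (F ** mat a) ** mat_poly F p"
    by (simp add: pCons.IH matrix_mul_assoc)
  also have "\<dots> = mat a ** mat_poly F (pCons b p)"
    unfolding matrix_mul_mat_commute
    by (simp add: mat_matrix_mul_mat matrix_add_ldistrib matrix_mul_assoc)
  finally show ?case .
qed (simp add: matrix_mul_zero_right)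

lemma mat_poly_commute: "F ** mat_poly F p = mat_poly F p ** F"
proof (induction p)
  case (pCons b p)
  have "F ** mat_poly F (pCons b p) = F ** mat b + F ** (F ** mat_poly F p)"
    by (simp add: matrix_add_ldistrib)
  also have "\<dots> = mat b ** F + (F ** mat_poly F p) ** F"
    by (simp only: matrix_mul_mat_commute pCons.IH matrix_mul_assoc)
  also have "\<dots> = mat_poly F (pCons b p) ** F"
    by (simp add: matrix_add_mult_rdistrib)
  finally show ?case .
qed (simp add: matrix_matrix_mult_def vec_eq_iff)

text \<open>A polynomial in \<open>F\<close> commutes with \<open>F\<close>, so the factor
  \<open>F - z\<close> may act first. Hence if \<open>(X - z) p\<close> annihilates a trajectory
  \<open>y\<close>, then \<open>p\<close> annihilates \<open>y' - z y\<close>.\<close>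

lemma mat_poly_linear_factor:
  fixes F :: "'a::field^'n^'n"
  shows
  "mat_poly F ([:- z, 1:] * p) *v v = mat_poly F p *v (F *v v - z *s v)"
proof -
  have "mat_poly F ([:- z, 1:] * p) *v v = mat (- z) *v (mat_poly F p *v v) + (F ** mat_poly F p) *v v"
  proof -
    have "[:- z, 1:] * p = smult (- z) p + pCons 0 p"
      by simp
    then show ?thesis
      by (simp only: mat_poly_add mat_poly_smult matrix_vector_mult_add_rdistrib
          matrix_vector_mul_assoc mat_poly_pCons mat_0_eq add_0)
  qed
  also have "\<dots> = mat_poly F p *v (F *v v) - z *s (mat_poly F p *v v)"
    unfolding mat_poly_commute mat_vector_mul_eq
    by (simp add: matrix_vector_mul_assoc vec_eq_iff)
  also have "\<dots> = mat_poly F p *v (F *v v - z *s v)"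
    by (simp add: matrix_vector_mult_diff_distrib vector_scalar_commute)
  finally show ?thesis .
qed

lemma mat_of_real_mul: "mat (complex_of_real a) ** M = a *\<^sub>R M"
  for M :: "complex^'n^'m"
  by (simp add: mat_matrix_mul_eq vec_eq_iff scaleR_conv_of_real [where 'a = complex])

text \<open>The powers of \<open>F\<close> live in a finite-dimensional real space, so sufficiently
  many of them satisfy a nontrivial linear relation, whose coefficients may even be real.\<close>

lemma annihilating_poly:
  fixes F :: "complex^'n^'n"
  obtains p where "p \<noteq> 0" "mat_poly F p = 0"
proof -
  define P where "P i = mat_poly F (monom 1 i)" for i
  define N where "N = DIM(complex^'n^'n)"
  show ?thesis
  proof (cases "inj_on P {..N}")
    case True
    \<comment> \<open>The exponents \<open>0\<close> to \<open>N\<close> give \<open>N + 1\<close>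
      distinct matrices, one more than the real dimension.\<close>
    have "dependent (P ` {..N})"
      by (rule dependent_biggerset, unfold card_image [OF True]) (simp add: N_def)
    then obtain u k where k: "k \<le> N" "u (P k) \<noteq> 0"
      and sum0: "(\<Sum>v\<in>P ` {..N}. u v *\<^sub>R v) = 0"
      by (subst (asm) real_vector.dependent_finite) auto
    define p where "p = (\<Sum>i\<le>N. smult (complex_of_real (u (P i))) (monom 1 i))"
    have "coeff p k = complex_of_real (u (P k))"
      using k by (simp add: p_def coeff_sum if_distrib cong: if_cong)
    then have "p \<noteq> 0"
      using k by auto
    moreover have "mat_poly F p = (\<Sum>i\<le>N. u (P i) *\<^sub>R P i)"
      by (simp add: p_def mat_poly_sum mat_poly_smult mat_of_real_mul P_def)
    then have "mat_poly F p = 0"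
      using sum0 by (simp add: sum.reindex [OF True])
    ultimately show ?thesis
      by (rule that)
  next
    case False
    then obtain i j where ij: "i \<noteq> j" "P i = P j"
      by (auto simp: inj_on_def)
    \<comment> \<open>A repeated power gives a relation directly: the difference of the two
      monomials.\<close>
    have "mat_poly F (monom 1 i + smult (complex_of_real (- 1)) (monom 1 j)) = 0"
      unfolding mat_poly_add mat_poly_smult mat_of_real_mul using ij by (simp add: P_def)
    moreover have "coeff (monom 1 i + smult (complex_of_real (- 1)) (monom 1 j)) i \<noteq> 0"
      using ij by simp
    ultimately show ?thesis
      by (metis that coeff_0)
  qed
qed

section \<open>Real and complex vectors\<close>

definition cvec :: "real^'n \<Rightarrow> complex^'n" where
  "cvec x = (\<chi> i. complex_of_real (x $ i))"

definition rvec :: "complex^'n \<Rightarrow> real^'n" where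
  "rvec v = (\<chi> i. Re (v $ i))"

lemma bounded_linear_cvec: "bounded_linear cvec"
  by (auto simp: cvec_def vec_eq_iff scaleR_conv_of_real [where 'a = complex]
      intro!: linearI simp flip: linear_conv_bounded_linear)

lemma bounded_linear_rvec: "bounded_linear rvec"
  by (auto simp: rvec_def vec_eq_iff intro!: linearI simp flip: linear_conv_bounded_linear)

lemma norm_cvec [simp]: "norm (cvec x) = norm x"
  by (simp add: cvec_def norm_vec_def)

lemma cvec_matrix_vector_mul: "cvec (F *v x) = map_matrix complex_of_real F *v cvec x"
  by (simp add: cvec_def matrix_vector_mult_def vec_eq_iff)

lemma rvec_matrix_vector_mul: "rvec (map_matrix complex_of_real F *v v) = F *v rvec v"
  by (simp add: rvec_def matrix_vector_mult_def vec_eq_iff)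

lemma norm_complex_vector_scalar_mult: "norm (c *s v) = norm c * norm v"
  for v :: "complex^'n"
  by (simp add: norm_vec_def norm_mult L2_set_right_distrib)

lemma bounded_bilinear_vector_scalar_mult:
  "bounded_bilinear ((*s) :: complex \<Rightarrow> complex^'n \<Rightarrow> complex^'n)"
proof
  show "\<exists>K. \<forall>a b. norm (a *s b :: complex^'n) \<le> norm a * norm b * K"
    by (rule exI [of _ 1]) (simp add: norm_complex_vector_scalar_mult)
qed (simp_all add: vec_eq_iff algebra_simps)

lemma exp_of_real_has_vector_derivative:
  "((\<lambda>t. exp (z * complex_of_real t)) has_vector_derivative z * exp (z * complex_of_real t))
    (at t within S)"
  by (rule has_vector_derivative_real_field) (auto intro!: derivative_eq_intros)

section \<open>Eigenvalues and exponential stability\<close>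

text \<open>Integrating factor: \<open>exp (- z t) y\<close> has derivative
  \<open>exp (- z t) w\<close>, of norm at most \<open>C exp (s t)\<close> with
  \<open>s = - Re z - r > 0\<close>. Integrating this bound and multiplying back gives the
  claim.\<close>

lemma forced_scalar_decay:
  fixes y w :: "real \<Rightarrow> complex^'n"
  assumes deriv: "\<And>t. t \<ge> 0 \<Longrightarrow> (y has_vector_derivative z *s y t + w t) (at t within {0..})"
    and bound: "\<And>t. t \<ge> 0 \<Longrightarrow> norm (w t) \<le> C * exp (- r * t)"
    and "r < - Re z" "t \<ge> 0"
  shows "norm (y t) \<le> (norm (y 0) + C / (- Re z - r)) * exp (- r * t)"
proof -
  define s where "s = - Re z - r"
  have s: "s > 0" using assms by (simp add: s_def)
  have "0 \<le> C"
    using order_trans [OF norm_ge_zero bound [of 0]] by simp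
  define g where "g t = exp (- z * complex_of_real t) *s y t" for t
  define \<phi> where "\<phi> t = C / s * exp (s * t)" for t
  have exp_factor: "norm (exp (- z * complex_of_real u)) = exp ((s + r) * u)" for u
    by (simp add: s_def)
  have gd: "(g has_vector_derivative exp (- z * complex_of_real u) *s w u) (at u within {0..})"
    if "u \<ge> 0" for u
  proof -
    have "(g has_vector_derivative
        exp (- z * complex_of_real u) *s (z *s y u + w u)
          + (- z * exp (- z * complex_of_real u)) *s y u) (at u within {0..})"
      unfolding g_def
      by (rule bounded_bilinear.has_vector_derivative [OF bounded_bilinear_vector_scalar_mult
            exp_of_real_has_vector_derivative deriv [OF that]])
    then show ?thesis
      by (rule back_subst [where P = "\<lambda>d. (g has_vector_derivative d) (at u within {0..})"])
        (simp add: vec_eq_iff algebra_simps)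
  qed
  have \<phi>d: "(\<phi> has_vector_derivative C * exp (s * u)) (at u within S)" for u S
    unfolding \<phi>_def has_real_derivative_iff_has_vector_derivative [symmetric]
    using s by (auto intro!: derivative_eq_intros)
  have "norm (g t - g 0) \<le> \<phi> t - \<phi> 0" if "t > 0"
  proof (rule differentiable_bound_general [OF that])
    show "continuous_on {0..t} g"
      by (rule continuous_on_subset [OF continuous_on_vector_derivative [OF gd]]) auto
    show "continuous_on {0..t} \<phi>"
      using \<phi>d by (rule continuous_on_vector_derivative)
    fix u assume u: "0 < u" "u < t"
    \<comment> \<open>At interior times the derivative relative to \<open>{0..}\<close> is
      two-sided, as the mean value bound requires.\<close>
    have "(g has_vector_derivative exp (- z * complex_of_real u) *s w u) (at u within {0<..})"
      using gd [of u] u by (auto intro: has_vector_derivative_within_subset)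
    then show "(g has_vector_derivative exp (- z * complex_of_real u) *s w u) (at u)"
      using u has_vector_derivative_within_open [of u "{0<..}" g] by simp
    show "(\<phi> has_vector_derivative C * exp (s * u)) (at u)"
      by (rule \<phi>d)
    have "norm (exp (- z * complex_of_real u) *s w u) \<le> exp ((s + r) * u) * (C * exp (- r * u))"
      unfolding norm_complex_vector_scalar_mult exp_factor
      using bound [of u] u by (intro mult_left_mono) auto
    also have "\<dots> = C * exp (s * u)"
      by (simp add: exp_add [symmetric] algebra_simps)
    finally show "norm (exp (- z * complex_of_real u) *s w u) \<le> C * exp (s * u)" .
  qed
  then have "norm (g t - g 0) \<le> \<phi> t - \<phi> 0"
    using \<open>t \<ge> 0\<close> by (cases "t = 0") auto
  moreover have "\<phi> 0 \<ge> 0"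
    using s \<open>0 \<le> C\<close> by (simp add: \<phi>_def)
  moreover have "g 0 = y 0"
    by (simp add: g_def)
  moreover have "norm (g t) \<le> norm (g t - g 0) + norm (g 0)"
    using norm_triangle_ineq [of "g t - g 0" "g 0"] by simp
  ultimately have "norm (g t) \<le> norm (y 0) + \<phi> t"
    by simp
  \<comment> \<open>Since \<open>s * t \<ge> 0\<close>, the initial term is absorbed into the same
    exponential as \<open>\<phi>\<close>.\<close>
  moreover have "norm (y 0) \<le> norm (y 0) * exp (s * t)"
    using s \<open>t \<ge> 0\<close> by (simp add: mult_le_cancel_left1)
  ultimately have "exp ((s + r) * t) * norm (y t) \<le> (norm (y 0) + C / s) * exp (s * t)"
    unfolding g_def norm_complex_vector_scalar_mult exp_factor by (simp add: \<phi>_def algebra_simps)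
  then have "exp (- (s + r) * t) * (exp ((s + r) * t) * norm (y t))
      \<le> exp (- (s + r) * t) * ((norm (y 0) + C / s) * exp (s * t))"
    by (intro mult_left_mono) auto
  moreover have "exp (- (s + r) * t) * exp ((s + r) * t) = 1"
    "exp (- (s + r) * t) * exp (s * t) = exp (- r * t)"
    by (simp_all add: exp_add [symmetric] algebra_simps)
  ultimately show ?thesis
    unfolding s_def [symmetric] mult.left_commute [of _ "norm (y 0) + C / s"]
    by (simp only: mult.assoc [symmetric] mult_1_left)
qed

text \<open>Induction on the degree, splitting off one root at a time. Annihilation is asked only
  along \<open>y\<close>, since the quotient \<open>q\<close> need not annihilate \<open>F\<close>.
  The strict gap \<open>r < - Re z\<close> keeps the rate \<open>r\<close> at every step, so
  repeated roots cost only a larger constant.\<close>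

lemma annihilated_trajectory_decay:
  fixes F :: "complex^'n^'n"
  assumes "p \<noteq> 0"
    and "\<And>z. poly p z = 0 \<Longrightarrow> is_eigenvalue F z \<Longrightarrow> r < - Re z"
  shows "\<exists>K\<ge>0. \<forall>y. (\<forall>t\<ge>0. (y has_vector_derivative F *v y t) (at t within {0..})) \<longrightarrow>
      (\<forall>t\<ge>0. mat_poly F p *v y t = 0) \<longrightarrow>
      (\<forall>t\<ge>0. norm (y t) \<le> K * exp (- r * t) * norm (y 0))"
  using assms
proof (induction "degree p" arbitrary: p)
  case 0
  then obtain a where "p = [:a:]" "a \<noteq> 0"
    by (metis degree_eq_zeroE pCons_0_0)
  then have "mat_poly F p *v v = 0 \<longleftrightarrow> v = 0" for v
    by (simp add: matrix_mul_zero_right mat_vector_mul_eq)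
  then show ?case
    \<comment> \<open>A nonzero constant annihilates only the zero vector, so the trajectory
      vanishes.\<close>
    by (intro exI [of _ 0]) auto
next
  case (Suc n)
  then obtain z where z: "poly p z = 0"
    using alg_closed_imp_poly_has_root [of p] by auto
  then obtain q where p: "p = [:- z, 1:] * q"
    by (auto simp: poly_eq_0_iff_dvd)
  then have "q \<noteq> 0" using Suc.prems by auto
  then have "degree p = Suc (degree q)"
    unfolding p by (subst degree_mult_eq) auto
  then have "n = degree q"
    using Suc.hyps(2) by simp
  then obtain K where K: "K \<ge> 0" and decay:
    "\<And>y t. \<lbrakk>\<forall>t\<ge>0. (y has_vector_derivative F *v y t) (at t within {0..});
      \<forall>t\<ge>0. mat_poly F q *v y t = 0; t \<ge> 0\<rbrakk> \<Longrightarrow> norm (y t) \<le> K * exp (- r * t) * norm (y 0)"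
    using Suc.hyps(1) [of q] Suc.prems \<open>q \<noteq> 0\<close> by (auto simp: p)
  show ?case
  proof (cases "is_eigenvalue F z")
    case False
    then have inj: "F *v v - z *s v = 0 \<Longrightarrow> v = 0" for v
      by (auto simp: is_eigenvalue_def)
    \<comment> \<open>\<open>F - z\<close> is injective and commutes with \<open>q\<close> evaluated
      at \<open>F\<close>, so it can be cancelled.\<close>
    have "mat_poly F q *v v = 0" if "mat_poly F p *v v = 0" for v
    proof (rule inj)
      let ?v = "mat_poly F q *v v"
      have "F *v ?v - z *s ?v = mat_poly F q *v (F *v v - z *s v)"
        by (simp add: matrix_vector_mul_assoc mat_poly_commute matrix_vector_mult_diff_distrib
            vector_scalar_commute)
      then show "F *v ?v - z *s ?v = 0"
        using that by (simp only: p mat_poly_linear_factor)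
    qed
    then show ?thesis
      using K by (intro exI [of _ K] conjI allI impI decay) auto
  next
    case True
    define L where "L v = F *v v - z *s v" for v
    have L: "bounded_linear L"
      unfolding L_def
      by (intro bounded_linear_sub matrix_vector_mul_bounded_linear
          bounded_bilinear.bounded_linear_right [OF bounded_bilinear_vector_scalar_mult])
    obtain B where B: "\<And>v. norm (L v) \<le> B * norm v" "B > 0"
      using bounded_linear.pos_bounded [OF L] by (metis mult.commute)
    have rz: "r < - Re z"
      using Suc.prems z True by blast
    show ?thesis
    \<comment> \<open>The summand 1 accounts for the initial value of \<open>y\<close>; the other
      bounds the forcing \<open>L (y t)\<close> by way of
      \<open>norm (L (y 0)) \<le> B * norm (y 0)\<close>, divided by the gap.\<close>
    proof (intro exI [of _ "1 + K * B / (- Re z - r)"] conjI allI impI)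
      show "0 \<le> 1 + K * B / (- Re z - r)"
        using K B rz by simp
    next
      fix y :: "real \<Rightarrow> complex^'n" and t :: real
      assume y: "\<forall>t\<ge>0. (y has_vector_derivative F *v y t) (at t within {0..})"
        and annih: "\<forall>t\<ge>0. mat_poly F p *v y t = 0" and t: "0 \<le> t"
      \<comment> \<open>\<open>L\<close> commutes with \<open>F\<close>, so it maps trajectories to
        trajectories.\<close>
      have "((\<lambda>t. L (y t)) has_vector_derivative F *v L (y t)) (at t within {0..})"
        if "t \<ge> 0" for t
        using bounded_linear.has_vector_derivative [OF L y [rule_format, OF that]]
        by (simp add: L_def matrix_vector_mult_diff_distrib vector_scalar_commute)
      moreover have "mat_poly F q *v L (y t) = 0" if "t \<ge> 0" for t
        using annih that by (simp only: p mat_poly_linear_factor L_def)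
      ultimately have Ly: "norm (L (y t)) \<le> K * exp (- r * t) * norm (L (y 0))" if "t \<ge> 0" for t
        using that by (intro decay) auto
      have "norm (L (y t)) \<le> (K * B * norm (y 0)) * exp (- r * t)" if "t \<ge> 0" for t
      proof -
        have "K * exp (- r * t) * norm (L (y 0)) \<le> K * exp (- r * t) * (B * norm (y 0))"
          using K B by (intro mult_left_mono) auto
        with Ly [OF that] show ?thesis
          by (simp add: mult_ac)
      qed
      moreover have "(y has_vector_derivative z *s y t + L (y t)) (at t within {0..})"
        if "t \<ge> 0" for t
        using y that by (simp add: L_def)
      ultimately have "norm (y t) \<le> (norm (y 0) + K * B * norm (y 0) / (- Re z - r)) * exp (- r * t)"
        using rz t by (intro forced_scalar_decay [where w = "\<lambda>t. L (y t)"]) auto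
      then show "norm (y t) \<le> (1 + K * B / (- Re z - r)) * exp (- r * t) * norm (y 0)"
        by (simp add: algebra_simps)
    qed
  qed
qed

lemma finite_pos_lower_bound:
  fixes S :: "real set"
  assumes "finite S" "\<And>x. x \<in> S \<Longrightarrow> x > 0"
  obtains r where "r > 0" "\<And>x. x \<in> S \<Longrightarrow> r < x"
proof
  \<comment> \<open>The extra element 1 covers the case of empty \<open>S\<close>; halving the
    minimum later makes the bound strict.\<close>
  define m where "m = Min (insert 1 S)"
  have "m > 0"
    using assms by (simp add: m_def)
  then show "m / 2 > 0"
    by simp
  show "m / 2 < x" if "x \<in> S" for x
  proof -
    have "m \<le> x"
      using assms(1) that by (simp add: m_def)
    with \<open>m > 0\<close> show ?thesis
      by linarith
  qed
qed

text \<open>An annihilating polynomial has finitely many roots, so one rate \<open>r > 0\<close>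
  serves all eigenvalues among them. Real trajectories are embedded by \<open>cvec\<close>, which
  preserves norms.\<close>

lemma exponentially_stable_if_eigenvalues:
  fixes F :: "real^'n^'n"
  assumes neg: "\<And>z. is_eigenvalue (map_matrix complex_of_real F) z \<Longrightarrow> Re z < 0"
  shows "exponentially_stable F"
proof -
  let ?F = "map_matrix complex_of_real F"
  obtain p where p: "p \<noteq> 0" "mat_poly ?F p = 0"
    by (rule annihilating_poly)
  have "finite ((\<lambda>z. - Re z) ` {z. poly p z = 0 \<and> is_eigenvalue ?F z})"
    using poly_roots_finite [OF p(1)] by simp
  then obtain r where r: "r > 0" "\<And>z. poly p z = 0 \<Longrightarrow> is_eigenvalue ?F z \<Longrightarrow> r < - Re z"
    by (rule finite_pos_lower_bound) (use neg in auto)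
  obtain K where K: "K \<ge> 0" "\<And>y t. \<forall>t\<ge>0. (y has_vector_derivative ?F *v y t) (at t within {0..}) \<Longrightarrow>
      t \<ge> 0 \<Longrightarrow> norm (y t) \<le> K * exp (- r * t) * norm (y 0)"
    using annihilated_trajectory_decay [of p ?F r] p r(2) by auto
  \<comment> \<open>\<open>K\<close> may be 0, whereas stability asks for a positive constant; hence
    \<open>K + 1\<close>.\<close>
  have "norm (x t) \<le> (K + 1) * exp (- r * t) * norm (x 0)"
    if "linear_trajectory F x" "t \<ge> 0" for x t
  proof -
    have "\<forall>t\<ge>0. ((\<lambda>t. cvec (x t)) has_vector_derivative ?F *v cvec (x t)) (at t within {0..})"
      using that(1) bounded_linear.has_vector_derivative [OF bounded_linear_cvec]
      by (fastforce simp: linear_trajectory_def simp flip: cvec_matrix_vector_mul)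
    from K(2) [OF this \<open>t \<ge> 0\<close>] have "norm (x t) \<le> K * exp (- r * t) * norm (x 0)"
      by simp
    also have "\<dots> \<le> (K + 1) * exp (- r * t) * norm (x 0)"
      by (intro mult_right_mono) auto
    finally show ?thesis .
  qed
  then show ?thesis
    unfolding exponentially_stable_def using K(1) r(1) by (intro exI [of _ "K + 1"] exI [of _ r]) auto
qed

text \<open>An eigenvector \<open>v\<close> gives the complex solution \<open>exp (z t) v\<close>,
  which does not decay if \<open>Re z \<ge> 0\<close>; its real and imaginary parts are controlled
  by real trajectories.\<close>

lemma Re_eigenvalue_if_exponentially_stable:
  fixes F :: "real^'n^'n"
  assumes "exponentially_stable F" and "is_eigenvalue (map_matrix complex_of_real F) z"
  shows "Re z < 0"
proof (rule ccontr)
  let ?F = "map_matrix complex_of_real F"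
  assume "\<not> Re z < 0"
  obtain v where v: "v \<noteq> 0" "?F *v v = z *s v"
    using assms(2) by (auto simp: is_eigenvalue_def)
  then obtain i where i: "v $ i \<noteq> 0"
    by (auto simp: vec_eq_iff)
  obtain K r where r: "r > 0" and stable:
    "\<And>x t. linear_trajectory F x \<Longrightarrow> t \<ge> 0 \<Longrightarrow> norm (x t) \<le> K * exp (- r * t) * norm (x 0)"
    using assms(1) by (auto simp: exponentially_stable_def)
  \<comment> \<open>The factor \<open>c\<close> is taken to be 1 and \<open>\<i>\<close>: the real
    part of \<open>\<i>\<close> times a solution is minus its imaginary part.\<close>
  define e where "e c t = (exp (z * complex_of_real t) * c) *s v" for c and t :: real
  have "linear_trajectory F (\<lambda>t. rvec (e c t))" for c
    unfolding linear_trajectory_def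
  proof (intro allI impI)
    fix t :: real
    have "(e c has_vector_derivative (z * exp (z * complex_of_real t) * c) *s v) (at t within {0..})"
      unfolding e_def
      by (intro bounded_linear.has_vector_derivative [OF bounded_bilinear.bounded_linear_left
            [OF bounded_bilinear_vector_scalar_mult]] has_vector_derivative_mult_left
          exp_of_real_has_vector_derivative)
    moreover have "(z * exp (z * complex_of_real t) * c) *s v = ?F *v e c t"
      by (simp add: e_def vector_scalar_commute v(2) mult.commute)
    ultimately show "((\<lambda>t. rvec (e c t)) has_vector_derivative F *v rvec (e c t)) (at t within {0..})"
      using bounded_linear.has_vector_derivative [OF bounded_linear_rvec]
      by (metis rvec_matrix_vector_mul)
  qed
  then have comp: "\<bar>Re (e c t $ i)\<bar> \<le> K * exp (- r * t) * norm (rvec (e c 0))" if "t \<ge> 0" for c t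
    using order_trans [OF component_le_norm_cart stable [of "\<lambda>t. rvec (e c t)" t], of i] that
    by (simp add: rvec_def)
  define C where "C = K * (norm (rvec (e 1 0)) + norm (rvec (e \<i> 0)))"
  have "norm (v $ i) \<le> C * exp (- r * t)" if "t \<ge> 0" for t
  proof -
    have "norm (v $ i) \<le> exp (Re z * t) * norm (v $ i)"
      using \<open>\<not> Re z < 0\<close> that by (simp add: mult_le_cancel_right1)
    also have "\<dots> = norm (e 1 t $ i)"
      by (simp add: e_def norm_mult)
    also have "\<dots> \<le> \<bar>Re (e 1 t $ i)\<bar> + \<bar>Im (e 1 t $ i)\<bar>"
      by (rule cmod_le)
    also have "\<bar>Im (e 1 t $ i)\<bar> = \<bar>Re (e \<i> t $ i)\<bar>"
      by (simp add: e_def)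
    finally show ?thesis
      using comp [OF that, of 1] comp [OF that, of \<i>] by (simp add: C_def algebra_simps)
  qed
  moreover have "((\<lambda>t. C * exp (- r * t)) \<longlongrightarrow> 0) at_top"
    using r by real_asymp
  \<comment> \<open>A constant that stays below a function tending to 0 is at most 0.\<close>
  ultimately have "norm (v $ i) \<le> 0"
    by (intro tendsto_lowerbound [of "\<lambda>t. C * exp (- r * t)" 0 at_top])
      (auto simp: eventually_at_top_linorder)
  then show False
    using i by simp
qed

lemma exponentially_stable_iff_eigenvalues:
  "exponentially_stable F \<longleftrightarrow>
    (\<forall>z. is_eigenvalue (map_matrix complex_of_real F) z \<longrightarrow> Re z < 0)"
  using exponentially_stable_if_eigenvalues Re_eigenvalue_if_exponentially_stable by blast

section \<open>Block triangular matrices\<close>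

lemma sum_UNIV_Plus: "sum f (UNIV :: ('a::finite + 'b::finite) set)
    = (\<Sum>a\<in>UNIV. f (Inl a)) + (\<Sum>b\<in>UNIV. f (Inr b))"
  by (subst UNIV_Plus_UNIV [symmetric], subst sum.Plus) auto

text \<open>Split an eigenvector into \<open>(a, b)\<close>. The lower rows give
  \<open>R b = z b\<close>; if \<open>b = 0\<close>, then \<open>a\<close> is nonzero and the upper
  rows give \<open>P a = z a\<close>.\<close>

lemma is_eigenvalue_block_triangular:
  fixes P :: "real^'k^'k" and Q :: "real^'l^'k" and R :: "real^'l^'l"
  assumes "is_eigenvalue (map_matrix complex_of_real
      (block_rows (block_cols P Q) (block_cols 0 R))) z"
  shows "is_eigenvalue (map_matrix complex_of_real P) z
    \<or> is_eigenvalue (map_matrix complex_of_real R) z"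
proof -
  obtain v where v: "v \<noteq> 0"
    "map_matrix complex_of_real (block_rows (block_cols P Q) (block_cols 0 R)) *v v = z *s v"
    using assms by (auto simp: is_eigenvalue_def)
  define a where "a = (\<chi> i. v $ Inl i)"
  define b where "b = (\<chi> i. v $ Inr i)"
  have eq: "(map_matrix complex_of_real (block_rows (block_cols P Q) (block_cols 0 R)) *v v) $ k
      = z * v $ k" for k
    by (simp add: v(2))
  have "(map_matrix complex_of_real R *v b) $ i = (z *s b) $ i" for i
    using eq [of "Inr i"]
    by (simp add: matrix_vector_mult_def sum_UNIV_Plus block_rows_def block_cols_def b_def)
  then have "map_matrix complex_of_real R *v b = z *s b"
    by (simp add: vec_eq_iff)
  moreover have "map_matrix complex_of_real P *v a = z *s a" if "b = 0"
  proof -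
    from that have "v $ Inr i = 0" for i
      by (simp add: b_def vec_eq_iff)
    then have "(map_matrix complex_of_real P *v a) $ i = (z *s a) $ i" for i
      using eq [of "Inl i"]
      by (simp add: matrix_vector_mult_def sum_UNIV_Plus block_rows_def block_cols_def a_def)
    then show ?thesis
      by (simp add: vec_eq_iff)
  qed
  moreover have "a \<noteq> 0 \<or> b \<noteq> 0"
  proof -
    obtain i where "v $ i \<noteq> 0"
      using v(1) by (auto simp: vec_eq_iff)
    then show ?thesis
      by (cases i) (auto simp: a_def b_def vec_eq_iff)
  qed
  ultimately show ?thesis
    unfolding is_eigenvalue_def by blast
qed

text \<open>The control enters only the upper rows and the gain reads only the physical state, so
  feedback alters the upper left block alone and the system stays block triangular.\<close>

lemma block_feedback:
  fixes P :: "real^'k^'k" and Q :: "real^'l^'k" and R :: "real^'l^'l"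
    and M :: "real^'c^'k" and G :: "real^'k^'c"
  shows "block_rows (block_cols P Q) (block_cols 0 R) + block_rows M 0 ** block_cols G 0
    = block_rows (block_cols (P + M ** G) Q) (block_cols 0 R)"
  by (auto simp: vec_eq_iff block_rows_def block_cols_def matrix_matrix_mult_def split: sum.split)

theorem mainTheorem4:
  fixes A_f :: "real^'f^'f" and B_f :: "real^'p^'f" and M_f :: "real^'c^'f"
    and A_u :: "real^'u^'u" and C_u :: "real^'u^'p"
  assumes "stabilizable A_f M_f"
    and "\<forall>z. is_eigenvalue (map_matrix complex_of_real A_u) z \<longrightarrow> Re z < 0"
  shows "stabilizable
           (block_rows (block_cols A_f (B_f ** C_u))
                       (block_cols (0 :: real^'f^'u) A_u))
           (block_rows M_f (0 :: real^'c^'u))"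
proof -
  obtain G where G: "exponentially_stable (A_f + M_f ** G)"
    using assms(1) by (auto simp: stabilizable_def)
  have "exponentially_stable (block_rows (block_cols A_f (B_f ** C_u)) (block_cols 0 A_u)
      + block_rows M_f 0 ** block_cols G 0)"
    \<comment> \<open>The hypothesis on \<open>G\<close> concerns trajectories and that on
      \<open>A_u\<close> eigenvalues; the spectral criterion lets them be combined.\<close>
    unfolding block_feedback exponentially_stable_iff_eigenvalues
    using is_eigenvalue_block_triangular G assms(2)
    by (blast dest: Re_eigenvalue_if_exponentially_stable)
  then show ?thesis
    unfolding stabilizable_def by blast
qed

end
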